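(* Let $D=(V,A)$ be a complete digraph with $d\ge1$ strongly connected components $K_1,\dots,K_d$, indexed in topological order (i.e. for $i<j$ every arc between $K_i$ and $K_j$ is directed from $K_i$ to $K_j$), and let $k_i$ be the number of vertices of $K_i$. Then the NL-flow polynomial of $D$ is given by $$\phi_{NL}^D(x)=\sum_{p=1}^d(-1)^{p-1}\sum_{(d_1,\dots,d_p)}\ \prod_{j=1}^p x^{\binom{n_j-1}{2}},$$ where the inner sum runs over all compositions $(d_1,\dots,d_p)$ of $d$ into $p$ parts (integers $d_i\ge1$ with $\sum_{i=1}^p d_i=d$), and for each such composition $$n_j:=\sum_{s=\delta(j-1)+1}^{\delta(j)}k_s,\qquad \delta(j):=\sum_{r=1}^j d_r .$$
   Context: A complete digraph here is a tournament, i.e. an orientation of a complete graph (exactly one arc between any two distinct vertices). Its strongly connected components are its maximal strongly connected subdigraphs. Contracting each of them to a vertex (condensation) yields a complete acyclic digraph on $d$ vertices, which has a unique topological ordering. By convention $\delta(0)=0$ and $\binom{0}{2}=\binom{1}{2}=0$. A directed cut of $D=(V,A)$ is a nonempty set of arcs consisting of all arcs with tail in $X$ and head in $V\setminus X$, for some $X\subseteq V$ such that no arc has tail in $V\setminus X$ and head in $X$. Let $\mathcal{C}=\{A\setminus C : C \text{ is a (possibly empty) union of directed cuts of } D\}$, partially ordered by $\supseteq$ (so $B\le B'$ iff $B\supseteq B'$). The Möbius function $\mu$ of a finite poset is defined by $\mu(x,y)=0$ if $x\not\le y$, $\mu(x,x)=1$, and $\mu(x,y)=-\sum_{x\le z<y}\mu(x,z)$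 if $x<y$. For $B\subseteq A$, $rk(B)$ is $|V|$ minus the number of connected components of $(V,B)$. The NL-flow polynomial of $D$ is $\phi_{NL}^D(x)=\sum_{B\in\mathcal{C}}\mu(A,B)\,x^{|B|-rk(B)}$, with $\mu$ the Möbius function of $(\mathcal{C},\supseteq)$. *)

theory Defs
  imports "Graph_Theory.Digraph_Component" "HOL-Computational_Algebra.Polynomial"
begin

section \<open>Tournaments and topologically ordered strong components\<close>

locale tournament = digraph +
  assumes ex1_arc: "\<lbrakk>u \<in> verts G; v \<in> verts G; u \<noteq> v\<rbrakk> \<Longrightarrow>
    \<exists>!e. e \<in> arcs G \<and> (arc_to_ends G e = (u, v) \<or> arc_to_ends G e = (v, u))"

definition sccs_topologically_ordered ::
    "('a, 'b) pre_digraph \<Rightarrow> nat \<Rightarrow> (nat \<Rightarrow> ('a, 'b) pre_digraph) \<Rightarrow> bool" where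
  "sccs_topologically_ordered G d K \<longleftrightarrow>
     bij_betw K {1..d} (pre_digraph.sccs G) \<and>
     (\<forall>i\<in>{1..d}. \<forall>j\<in>{1..d}. i < j \<longrightarrow>
       (\<forall>e\<in>arcs G.
          (tail G e \<in> verts (K i) \<and> head G e \<in> verts (K j) \<or>
           tail G e \<in> verts (K j) \<and> head G e \<in> verts (K i)) \<longrightarrow>
          tail G e \<in> verts (K i) \<and> head G e \<in> verts (K j)))"

section \<open>The Moebius function of a finite poset\<close>

text \<open>
  The poset is given by its order relation \<open>r\<close>, with carrier \<open>Field r\<close>.  The conditions that
  \<open>r\<close> is a finite partial order only serve to make the recursion well-founded.
\<close>

function mobius :: "'a rel \<Rightarrow> 'a \<Rightarrow> 'a \<Rightarrow> int" where
  "mobius r x y =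
     (if finite r \<and> Partial_order r \<and> (x, y) \<in> r then
        if x = y then 1
        else - (\<Sum>z\<in>{z. (x, z) \<in> r \<and> (z, y) \<in> r \<and> z \<noteq> y}. mobius r x z)
      else 0)"
  by pat_completeness auto
termination
proof (relation "measure (\<lambda>(r, x, y). card {w. (w, y) \<in> r})", goal_cases)
  case 1
  then show ?case by simp
next
  case (2 r x y z)
  then have r: "finite r" "antisym r" "trans r" "refl_on (Field r) r" and zy: "(z, y) \<in> r" "z \<noteq> y"
    by (auto simp: partial_order_on_def preorder_on_def)
  have "finite {w. (w, y) \<in> r}"
    by (rule finite_subset[of _ "fst ` r"]) (use r(1) in force)+
  moreover have "{w. (w, z) \<in> r} \<subseteq> {w. (w, y) \<in> r}"
    using zy r(3) by (auto dest: transD)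
  moreover have "(y, y) \<in> r"
    using zy r(4) by (auto simp: refl_on_def Field_def)
  moreover have "(y, z) \<notin> r"
    using zy r(2) by (auto dest: antisymD)
  ultimately have "card {w. (w, z) \<in> r} < card {w. (w, y) \<in> r}"
    by (intro psubset_card_mono) auto
  then show ?case by simp
qed

declare mobius.simps [simp del]

section \<open>The NL-flow polynomial\<close>

definition directed_cut :: "('a, 'b) pre_digraph \<Rightarrow> 'b set \<Rightarrow> bool" where
  "directed_cut G C \<longleftrightarrow> C \<noteq> {} \<and>
     (\<exists>X \<subseteq> verts G.
        C = {e \<in> arcs G. tail G e \<in> X \<and> head G e \<in> verts G - X} \<and>
        \<not> (\<exists>e \<in> arcs G. tail G e \<in> verts G - X \<and> head G e \<in> X))"

definition dicut_complements :: "('a, 'b) pre_digraph \<Rightarrow> 'b set set" where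
  "dicut_complements G = {arcs G - \<Union>\<S> | \<S>. \<S> \<subseteq> {C. directed_cut G C}}"

definition dicut_order :: "('a, 'b) pre_digraph \<Rightarrow> 'b set rel" where
  "dicut_order G =
     {(B, B'). B \<in> dicut_complements G \<and> B' \<in> dicut_complements G \<and> B \<supseteq> B'}"

lemma Field_dicut_order: "Field (dicut_order G) = dicut_complements G"
  by (auto simp: dicut_order_def Field_def)

lemma Partial_order_dicut_order: "Partial_order (dicut_order G)"
  unfolding partial_order_on_def preorder_on_def Field_dicut_order
  by (auto simp: dicut_order_def refl_on_def trans_def antisym_def)

lemma finite_dicut_order:
  assumes "finite (arcs G)"
  shows "finite (dicut_order G)"
proof (rule finite_subset)
  show "dicut_order G \<subseteq> Pow (arcs G) \<times> Pow (arcs G)"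
    by (auto simp: dicut_order_def dicut_complements_def)
qed (use assms in simp)

definition spanning_subdigraph :: "('a, 'b) pre_digraph \<Rightarrow> 'b set \<Rightarrow> ('a, 'b) pre_digraph" where
  "spanning_subdigraph G B = \<lparr>verts = verts G, arcs = B, tail = tail G, head = head G\<rparr>"

text \<open>
  Connectedness refers to the underlying undirected graph, and every vertex lies in a component.
\<close>

definition connected_components :: "('a, 'b) pre_digraph \<Rightarrow> ('a, 'b) pre_digraph set" where
  "connected_components G = {H. pre_digraph.max_subgraph G Digraph_Component.connected H}"

text \<open>
  In the finite case there are at most \<open>card (verts G)\<close> components, and the rank is at most
  \<open>card B\<close>, so the subtractions on natural numbers below do not truncate.
\<close>

definition rk :: "('a, 'b) pre_digraph \<Rightarrow> 'b set \<Rightarrow> nat" where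
  "rk G B = card (verts G) - card (connected_components (spanning_subdigraph G B))"

definition nl_flow_poly :: "('a, 'b) pre_digraph \<Rightarrow> int poly" where
  "nl_flow_poly G =
     (\<Sum>B\<in>dicut_complements G. monom (mobius (dicut_order G) (arcs G) B) (card B - rk G B))"

section \<open>Compositions\<close>

definition compositions :: "nat \<Rightarrow> nat \<Rightarrow> nat list set" where
  "compositions d p = {ds. length ds = p \<and> (\<forall>x\<in>set ds. 1 \<le> x) \<and> sum_list ds = d}"

text \<open>The parts are numbered from 1, so the \<open>r\<close>-th part of \<open>ds\<close> is \<open>ds ! (r - 1)\<close>.\<close>

definition partial_sum :: "nat list \<Rightarrow> nat \<Rightarrow> nat" where
  "partial_sum ds j = (\<Sum>r = 1..j. ds ! (r - 1))"

definition block_size :: "(nat \<Rightarrow> nat) \<Rightarrow> nat list \<Rightarrow> nat \<Rightarrow> nat" where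
  "block_size k ds j = (\<Sum>s = partial_sum ds (j - 1) + 1..partial_sum ds j. k s)"

end

theory Submission
  imports Defs
begin

text \<open>
  Let \<open>c v\<close> be the index of the strong component of \<open>v\<close>. A vertex set without entering arcs is an
  initial segment \<open>{v. c v \<le> m}\<close>, so the directed cuts are the sets
  \<open>{e. c (tail e) \<le> m < c (head e)}\<close> for \<open>1 \<le> m < d\<close>. Each of them contains an arc from level \<open>m\<close> to
  level \<open>m + 1\<close>, which lies in no other cut; hence the unions of cuts form a Boolean lattice on the
  subsets \<open>S\<close> of \<open>{1..<d}\<close>, with Moebius function \<open>(-1) ^ card S\<close>. Removing the cuts in \<open>S\<close> leaves the
  disjoint union of the tournaments induced on the blocks into which \<open>S\<close> divides \<open>1, \<dots>, d\<close>, and a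
  tournament on \<open>n\<close> vertices has nullity \<open>(n choose 2) - (n - 1) = (n - 1) choose 2\<close>. The sets \<open>S\<close>
  correspond to the compositions of \<open>d\<close> via partial sums.
\<close>

section \<open>The Moebius function of a Boolean lattice\<close>

text \<open>Expanding the product of the factors \<open>1 - 1\<close> over \<open>A\<close> gives
  this sum; the product is zero once there is a factor.\<close>

lemma sum_neg_one_card_Pow:
  assumes "finite A" "A \<noteq> {}"
  shows "(\<Sum>X\<in>Pow A. (-1) ^ card X) = (0 :: int)"
proof -
  have "(\<Prod>x\<in>A. 1 - 1) = (\<Sum>X\<in>Pow A. (-1) ^ card X * (\<Prod>x\<in>X. 1) * (\<Prod>x\<in>A - X. 1 :: int))"
    using assms(1) by (rule prod_diff_conv_sum)
  then show ?thesis
    using assms by (simp add: card_gt_0_iff zero_power)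
qed

text \<open>Induction on \<open>card S\<close>: the recursion runs over the proper subsets of
  \<open>S\<close>, and since the alternating sum over all subsets vanishes, they contribute minus
  the term of \<open>S\<close>. The parametrisation \<open>B\<close> admits any order isomorphic to
  inclusion, later reverse inclusion of arc sets.\<close>

lemma mobius_Boolean:
  fixes B :: "'a set \<Rightarrow> 'b"
  assumes r: "finite r" "Partial_order r" and U: "finite U" and inj: "inj_on B (Pow U)"
    and r_iff: "\<And>x y. (x, y) \<in> r \<longleftrightarrow> (\<exists>S T. x = B S \<and> y = B T \<and> S \<subseteq> T \<and> T \<subseteq> U)"
    and "S \<subseteq> U"
  shows "mobius r (B {}) (B S) = (-1) ^ card S"
  using \<open>S \<subseteq> U\<close>
proof (induction "card S" arbitrary: S rule: less_induct)
  case less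
  note S = \<open>S \<subseteq> U\<close>
  have fin: "finite S"
    using S U by (rule finite_subset)
  have eq_iff: "B X = B Y \<longleftrightarrow> X = Y" if "X \<subseteq> U" "Y \<subseteq> U" for X Y
    using inj that by (auto dest: inj_onD)
  have le_iff: "(B X, B Y) \<in> r \<longleftrightarrow> X \<subseteq> Y" if "X \<subseteq> U" "Y \<subseteq> U" for X Y
    using that by (auto simp: r_iff) (metis eq_iff subset_trans subsetD)
  show ?case
  proof (cases "S = {}")
    case True
    then show ?thesis
      using r S by (subst mobius.simps) (simp add: le_iff)
  next
    case False
    have below: "{z. (B {}, z) \<in> r \<and> (z, B S) \<in> r \<and> z \<noteq> B S} = B ` (Pow S - {S})" (is "?L = ?R")
    proof
      show "?L \<subseteq> ?R"
      proof
        fix z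
        assume z: "z \<in> ?L"
        then obtain T where T: "z = B T" "T \<subseteq> U"
          by (auto simp: r_iff)
        then show "z \<in> ?R"
          using z S by (auto simp: le_iff)
      qed
      show "?R \<subseteq> ?L"
        using S by (auto simp: le_iff eq_iff)
    qed
    have "mobius r (B {}) (B S) = - (\<Sum>z\<in>B ` (Pow S - {S}). mobius r (B {}) z)"
      using r S False by (subst mobius.simps) (simp add: le_iff eq_iff below)
    also have "(\<Sum>z\<in>B ` (Pow S - {S}). mobius r (B {}) z) = (\<Sum>T\<in>Pow S - {S}. mobius r (B {}) (B T))"
      using S by (subst sum.reindex) (auto intro!: inj_on_subset[OF inj])
    also have "\<dots> = (\<Sum>T\<in>Pow S - {S}. (-1) ^ card T)"
    proof (rule sum.cong)
      fix T
      assume "T \<in> Pow S - {S}"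
      then have "T \<subset> S"
        by auto
      then show "mobius r (B {}) (B T) = (-1) ^ card T"
        using S fin by (intro less) (auto intro: psubset_card_mono)
    qed simp
    also have "\<dots> = - ((-1) ^ card S)"
      using sum_neg_one_card_Pow[OF fin False] fin by (subst sum_diff) auto
    finally show ?thesis
      by simp
  qed
qed

section \<open>Compositions as sets of cut points\<close>

text \<open>
  \<open>block_of S s\<close> is the number, counted from 0, of the block containing \<open>s\<close> when a cut is made between
  \<open>m\<close> and \<open>m + 1\<close> for every \<open>m \<in> S\<close>.
\<close>

definition block_of :: "nat set \<Rightarrow> nat \<Rightarrow> nat" where
  "block_of S s = card {m \<in> S. m < s}"

text \<open>The cut points below \<open>s\<close> are among those below \<open>t\<close>, so equal
  counts force equal finite sets.\<close>

lemma block_of_eq_iff: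
  assumes "finite S" "s \<le> t"
  shows "block_of S s = block_of S t \<longleftrightarrow> (\<forall>m\<in>S. \<not> (s \<le> m \<and> m < t))"
proof
  assume eq: "block_of S s = block_of S t"
  have "{m \<in> S. m < s} = {m \<in> S. m < t}"
  proof (rule card_subset_eq)
    show "finite {m \<in> S. m < t}"
      using assms by simp
    show "{m \<in> S. m < s} \<subseteq> {m \<in> S. m < t}"
      using assms by auto
    show "card {m \<in> S. m < s} = card {m \<in> S. m < t}"
      using eq by (simp only: block_of_def)
  qed
  then show "\<forall>m\<in>S. \<not> (s \<le> m \<and> m < t)"
    by (metis (mono_tags, lifting) mem_Collect_eq not_le)
next
  assume "\<forall>m\<in>S. \<not> (s \<le> m \<and> m < t)"
  then have "{m \<in> S. m < s} = {m \<in> S. m < t}"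
    using assms(2) by (intro Collect_cong) (meson less_le_trans not_le)
  then show "block_of S s = block_of S t"
    by (simp only: block_of_def)
qed

text \<open>The indices 0 and \<open>length ds\<close> are left out: their partial sums are the two
  ends of the range and separate nothing.\<close>

definition cuts :: "nat list \<Rightarrow> nat set" where
  "cuts ds = partial_sum ds ` {1..<length ds}"

lemma partial_sum_0 [simp]: "partial_sum ds 0 = 0"
  by (simp add: partial_sum_def)

lemma partial_sum_Suc [simp]: "partial_sum ds (Suc j) = partial_sum ds j + ds ! j"
  by (simp add: partial_sum_def)

lemma partial_sum_length: "partial_sum ds (length ds) = sum_list ds"
  unfolding partial_sum_def sum_list_sum_nth
  by (rule sum.reindex_bij_witness[of _ Suc "\<lambda>r. r - 1"]) auto

section \<open>Blocks of a fixed composition\<close>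

context
  fixes d p :: nat and ds :: "nat list"
  assumes ds: "ds \<in> compositions d p"
begin

lemma length_composition: "length ds = p"
  using ds by (simp add: compositions_def)

lemma composition_ge_1: "j < p \<Longrightarrow> 1 \<le> ds ! j"
  using ds by (auto simp: compositions_def)

lemma partial_sum_total: "partial_sum ds p = d"
  using partial_sum_length[of ds] ds by (simp add: compositions_def)

lemma partial_sum_less: "i < j \<Longrightarrow> j \<le> p \<Longrightarrow> partial_sum ds i < partial_sum ds j"
proof (induction j)
  case (Suc j)
  have "partial_sum ds i \<le> partial_sum ds j"
    using Suc by (cases "i = j") auto
  then show ?case
    using composition_ge_1[of j] Suc.prems by simp
qed simp

lemma partial_sum_less_iff:
  "i \<le> p \<Longrightarrow> j \<le> p \<Longrightarrow> partial_sum ds i < partial_sum ds j \<longleftrightarrow> i < j"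
  using partial_sum_less[of i j] partial_sum_less[of j i] by (cases i j rule: linorder_cases) auto

lemma inj_on_partial_sum: "inj_on (partial_sum ds) {0..p}"
proof (rule inj_onI)
  fix i j
  assume "i \<in> {0..p}" "j \<in> {0..p}" "partial_sum ds i = partial_sum ds j"
  then show "i = j"
    using partial_sum_less[of i j] partial_sum_less[of j i] by (cases i j rule: linorder_cases) auto
qed

lemma cuts_subset: "cuts ds \<subseteq> {1..<d}"
proof
  fix m
  assume "m \<in> cuts ds"
  then obtain j where "m = partial_sum ds j" "1 \<le> j" "j < p"
    by (auto simp: cuts_def length_composition)
  then show "m \<in> {1..<d}"
    using partial_sum_less[of 0 j] partial_sum_less[of j p] by (simp add: partial_sum_total)
qed

lemma card_cuts: "card (cuts ds) = p - 1"
  unfolding cuts_def length_composition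
  by (subst card_image) (auto intro: inj_on_subset[OF inj_on_partial_sum])

text \<open>By strict monotonicity of the partial sums, exactly those with index \<open>1\<close> to
  \<open>j - 1\<close> are cut points below \<open>s\<close>. Parts are numbered from 1 and blocks
  from 0.\<close>

lemma block_of_cuts:
  assumes "1 \<le> j" "j \<le> p" "partial_sum ds (j - 1) < s" "s \<le> partial_sum ds j"
  shows "block_of (cuts ds) s = j - 1"
proof -
  have "{m \<in> cuts ds. m < s} = partial_sum ds ` {1..<j}" (is "?L = ?R")
  proof
    show "?L \<subseteq> ?R"
    proof
      fix m
      assume "m \<in> ?L"
      then obtain i where i: "m = partial_sum ds i" "1 \<le> i" "i < p" "m < s"
        by (auto simp: cuts_def length_composition)
      then have "partial_sum ds i < partial_sum ds j"
        using assms by simp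
      then show "m \<in> ?R"
        using i assms by (auto simp: partial_sum_less_iff)
    qed
    show "?R \<subseteq> ?L"
    proof
      fix m
      assume "m \<in> ?R"
      then obtain i where i: "m = partial_sum ds i" "1 \<le> i" "i < j"
        by auto
      then have "partial_sum ds i \<le> partial_sum ds (j - 1)"
        using partial_sum_less[of i "j - 1"] assms by (cases "i = j - 1") (auto simp: less_imp_le)
      then show "m \<in> ?L"
        using i assms by (auto simp: cuts_def length_composition)
    qed
  qed
  then have "block_of (cuts ds) s = card (partial_sum ds ` {1..<j})"
    by (simp add: block_of_def)
  also have "\<dots> = j - 1"
    using assms by (subst card_image) (auto intro: inj_on_subset[OF inj_on_partial_sum])
  finally show ?thesis .
qed

lemma block_of_cuts_fibre:
  assumes "1 \<le> j" "j \<le> p"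
  shows "{s \<in> {1..d}. block_of (cuts ds) s = j - 1} = {partial_sum ds (j - 1) + 1..partial_sum ds j}"
    (is "?L = ?R")
proof
  show "?R \<subseteq> ?L"
  proof
    fix s
    assume s: "s \<in> ?R"
    have "partial_sum ds j \<le> d"
      using partial_sum_less[of j p] assms by (cases "j = p") (auto simp: partial_sum_total)
    then show "s \<in> ?L"
      using s assms block_of_cuts[of j s] by simp
  qed
  show "?L \<subseteq> ?R"
  proof
    fix s
    assume s: "s \<in> ?L"
    \<comment> \<open>The part whose interval contains \<open>s\<close> is found as the first one
      whose partial sum reaches \<open>s\<close>.\<close>
    define i where "i = (LEAST i. s \<le> partial_sum ds i)"
    have "s \<le> partial_sum ds p"
      using s by (simp add: partial_sum_total)
    then have i: "s \<le> partial_sum ds i" "i \<le> p"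
      unfolding i_def by (fact LeastI Least_le)+
    have "1 \<le> i"
      using i(1) s by (cases i) auto
    moreover have "partial_sum ds (i - 1) < s"
      using not_less_Least[of "i - 1" "\<lambda>i. s \<le> partial_sum ds i"] \<open>1 \<le> i\<close>
      by (simp add: i_def[symmetric] not_le)
    ultimately have "block_of (cuts ds) s = i - 1"
      using i by (intro block_of_cuts)
    \<comment> \<open>Both indices are at least 1, so \<open>i - 1 = j - 1\<close> can be
      cancelled.\<close>
    then have "i = j"
      using s \<open>1 \<le> i\<close> assms by auto
    then show "s \<in> ?R"
      using i \<open>partial_sum ds (i - 1) < s\<close> by simp
  qed
qed

lemma block_size_eq:
  assumes "1 \<le> j" "j \<le> p"
  shows "block_size k ds j = (\<Sum>s | s \<in> {1..d} \<and> block_of (cuts ds) s = j - 1. k s)"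
  unfolding block_size_def using block_of_cuts_fibre[OF assms] by simp

text \<open>Recovers the parts from the cut set alone, which is what makes \<open>cuts\<close>
  injective.\<close>

lemma composition_nth_eq:
  assumes "j < p"
  shows "ds ! j = card {s \<in> {1..d}. block_of (cuts ds) s = j}"
  using block_of_cuts_fibre[of "Suc j"] assms by simp

end

section \<open>Bijection between compositions and cut sets\<close>

lemma inj_on_cuts: "inj_on cuts (compositions d p)"
proof (rule inj_onI)
  fix ds es
  assume ds: "ds \<in> compositions d p" and es: "es \<in> compositions d p" and eq: "cuts ds = cuts es"
  show "ds = es"
  proof (rule nth_equalityI)
    show "ds ! i = es ! i" if "i < length ds" for i
      using that composition_nth_eq[OF ds, of i] composition_nth_eq[OF es, of i] eq
      by (simp add: length_composition[OF ds])
  qed (simp add: length_composition[OF ds] length_composition[OF es])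
qed

lemma cuts_surj:
  assumes S: "S \<subseteq> {1..<d}" and p: "card S = p - 1" "1 \<le> p" and "1 \<le> d"
  shows "\<exists>ds\<in>compositions d p. cuts ds = S"
proof -
  have fin: "finite S"
    using S by (rule finite_subset) simp
  define xs where "xs = sorted_list_of_set S"
  \<comment> \<open>The cut points in increasing order, padded with both ends; the parts are the
    consecutive differences, so their partial sums telescope back to \<open>es\<close>.\<close>
  define es where "es = 0 # xs @ [d]"
  define ds where "ds = map (\<lambda>i. es ! Suc i - es ! i) [0..<p]"
  have xs: "set xs = S" "sorted_wrt (<) xs" "length xs = p - 1"
    using fin p by (simp_all add: xs_def)
  have len: "length es = Suc p"
    using xs p by (simp add: es_def)
  \<comment> \<open>If there are no cut points, \<open>es\<close> is \<open>[0, d]\<close>, and it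
    increases because \<open>d\<close> is positive.\<close>
  have "sorted_wrt (<) es"
    using xs S \<open>1 \<le> d\<close> by (auto simp: es_def sorted_wrt_append)
  then have step: "es ! i < es ! Suc i" if "i < p" for i
    using that len by (simp add: sorted_wrt_iff_nth_less)
  have ps: "partial_sum ds j = es ! j" if "j \<le> p" for j
    using that
  proof (induction j)
    case (Suc j)
    then show ?case
      using step[of j] by (simp add: ds_def)
  qed (simp add: es_def)
  have length: "length ds = p"
    by (simp add: ds_def)
  have "es ! p = d"
    using xs p by (cases p) (simp_all add: es_def nth_append)
  then have "sum_list ds = d"
    using ps[of p] partial_sum_length[of ds] length by simp
  moreover have "\<forall>x\<in>set ds. 1 \<le> x"
    using step by (auto simp: ds_def Suc_le_eq)
  ultimately have "ds \<in> compositions d p"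
    using length by (simp add: compositions_def)
  moreover have "cuts ds = S"
  proof -
    have "cuts ds = (\<lambda>j. es ! j) ` {1..<p}"
      unfolding cuts_def length by (rule image_cong) (simp_all add: ps)
    also have "{1..<p} = Suc ` {..<p - 1}"
      unfolding image_Suc_lessThan using p by auto
    also have "(\<lambda>j. es ! j) ` (Suc ` {..<p - 1}) = (\<lambda>j. xs ! j) ` {..<p - 1}"
      unfolding image_image using xs by (intro image_cong) (auto simp: es_def nth_append)
    also have "\<dots> = S"
      using xs by (auto simp: set_conv_nth)
    finally show ?thesis .
  qed
  ultimately show ?thesis
    by blast
qed

lemma bij_betw_cuts:
  assumes "1 \<le> p" "1 \<le> d"
  shows "bij_betw cuts (compositions d p) {S. S \<subseteq> {1..<d} \<and> card S = p - 1}"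
  unfolding bij_betw_def
proof
  show "cuts ` compositions d p = {S. S \<subseteq> {1..<d} \<and> card S = p - 1}"
  proof (intro equalityI subsetI)
    fix S
    assume "S \<in> cuts ` compositions d p"
    then show "S \<in> {S. S \<subseteq> {1..<d} \<and> card S = p - 1}"
      by (auto simp: card_cuts dest: cuts_subset[THEN subsetD])
  next
    fix S
    assume "S \<in> {S. S \<subseteq> {1..<d} \<and> card S = p - 1}"
    then show "S \<in> cuts ` compositions d p"
      using cuts_surj[of S d p] assms by auto
  qed
qed (rule inj_on_cuts)

section \<open>Connected components and adjacency classes\<close>

text \<open>Induction along an undirected walk in \<open>H\<close>, each step of which is an arc of
  \<open>G\<close> and preserves \<open>f\<close>.\<close>

lemma connected_imp_constant:
  assumes sub: "subgraph H G" and conn: "Digraph_Component.connected H"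
    and arc: "\<And>e. e \<in> arcs G \<Longrightarrow> f (tail G e) = f (head G e)"
    and uv: "u \<in> verts H" "v \<in> verts H"
  shows "f u = f v"
proof -
  have "(u, v) \<in> rtrancl_on (verts H) ((arcs_ends H)\<^sup>s)"
    using conn uv by (simp add: connected_conv)
  then show ?thesis
  proof (induction rule: rtrancl_on_induct)
    case (step y z)
    have "(y, z) \<in> (arcs_ends G)\<^sup>s"
      using step(2) arcs_ends_mono[OF sub] by (auto simp: symcl_def)
    then have "f y = f z"
      using arc by (auto simp: symcl_def arcs_ends_conv)
    with step show ?case
      by simp
  qed simp
qed

text \<open>A connected subgraph cannot leave a fibre of \<open>f\<close>, and a nonempty fibre is
  connected because any two of its vertices are adjacent. So the induced subdigraphs on the fibres
  are the maximal connected ones.\<close>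

lemma connected_components_eq_fibres:
  assumes wf: "wf_digraph G"
    and arc: "\<And>e. e \<in> arcs G \<Longrightarrow> f (tail G e) = f (head G e)"
    and adj: "\<And>u v. u \<in> verts G \<Longrightarrow> v \<in> verts G \<Longrightarrow> u \<noteq> v \<Longrightarrow> f u = f v \<Longrightarrow>
      (u, v) \<in> (arcs_ends G)\<^sup>s"
  shows "connected_components G = (\<lambda>c. G \<restriction> {v \<in> verts G. f v = c}) ` f ` verts G"
proof -
  interpret wf_digraph G
    by (rule wf)
  define F where "F c = G \<restriction> {v \<in> verts G. f v = c}" for c
  have verts_F: "verts (F c) = {v \<in> verts G. f v = c}" for c
    by (simp add: F_def)
  have sub_F: "subgraph (F c) G" for c
    unfolding F_def by (rule subgraph_induce_subgraphI) auto
  have conn_F: "Digraph_Component.connected (F c)" if "c \<in> f ` verts G" for c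
    unfolding connected_conv
  proof (intro conjI ballI)
    show "verts (F c) \<noteq> {}"
      using that by (auto simp: verts_F)
  next
    fix u v
    assume uv: "u \<in> verts (F c)" "v \<in> verts (F c)"
    show "(u, v) \<in> rtrancl_on (verts (F c)) ((arcs_ends (F c))\<^sup>s)"
    proof (cases "u = v")
      case True
      then show ?thesis
        using uv by simp
    next
      case False
      then have "(u, v) \<in> (arcs_ends G)\<^sup>s"
        using uv by (intro adj) (auto simp: verts_F)
      then have "(u, v) \<in> (arcs_ends (F c))\<^sup>s"
        using uv by (auto simp: symcl_def arcs_ends_conv F_def)
      then show ?thesis
        using uv by (auto intro: rtrancl_on_into_rtrancl_on)
    qed
  qed
  show ?thesis
    unfolding F_def[symmetric]
  proof (intro equalityI subsetI)
    fix H
    assume "H \<in> connected_components G"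
    then have H: "subgraph H G" "Digraph_Component.connected H"
      and max: "\<And>H'. H' \<noteq> H \<Longrightarrow> subgraph H H' \<Longrightarrow> subgraph H' G \<Longrightarrow>
        \<not> Digraph_Component.connected H'"
      by (auto simp: connected_components_def max_subgraph_def)
    obtain u where u: "u \<in> verts H"
      using H(2) by (auto simp: connected_conv)
    have "u \<in> verts G"
      using u H(1) by auto
    have "f w = f u" if "w \<in> verts H" for w
      using H arc that u by (rule connected_imp_constant)
    then have "verts H \<subseteq> verts (F (f u))"
      using subgraph_imp_subverts[OF H(1)] by (auto simp: verts_F)
    moreover have "tail H e \<in> verts H \<and> head H e \<in> verts H" if "e \<in> arcs H" for e
      using H(1) that by (auto simp: subgraph_def wf_digraph.wellformed)
    ultimately have "subgraph H (F (f u))"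
      using H(1) sub_F[of "f u"]
      by (auto simp: subgraph_def compatible_def F_def)
    then have "H = F (f u)"
      using max[of "F (f u)"] sub_F conn_F \<open>u \<in> verts G\<close> by auto
    then show "H \<in> F ` f ` verts G"
      using \<open>u \<in> verts G\<close> by blast
  next
    fix H
    assume "H \<in> F ` f ` verts G"
    then obtain u where u: "u \<in> verts G" and H: "H = F (f u)"
      by auto
    have "max_subgraph Digraph_Component.connected H"
    proof (rule max_subgraphI)
      show "Digraph_Component.connected H" "subgraph H G"
        using u conn_F sub_F by (auto simp: H)
    next
      fix H'
      assume H': "H \<noteq> H'" "subgraph H H'" "subgraph H' G"
      show "\<not> Digraph_Component.connected H'"
      proof
        assume conn: "Digraph_Component.connected H'"
        have "u \<in> verts H'"
          using u subgraph_imp_subverts[OF H'(2)] by (auto simp: H verts_F)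
        have "f w = f u" if "w \<in> verts H'" for w
          using H'(3) conn arc that \<open>u \<in> verts H'\<close> by (rule connected_imp_constant)
        then have "verts H' \<subseteq> verts H"
          using subgraph_imp_subverts[OF H'(3)] by (auto simp: H verts_F)
        then have verts: "verts H' = verts H"
          using subgraph_imp_subverts[OF H'(2)] by blast
        \<comment> \<open>Components are digraphs, so equal vertex sets do not suffice; since
          \<open>H\<close> is induced, \<open>H'\<close> cannot have further arcs.\<close>
        have "tail H' e \<in> verts H' \<and> head H' e \<in> verts H'" if "e \<in> arcs H'" for e
          using H'(3) that by (auto simp: subgraph_def wf_digraph.wellformed)
        then have "arcs H' \<subseteq> arcs H"
          using H'(3) unfolding verts by (auto simp: subgraph_def compatible_def H F_def)
        then have "arcs H' = arcs H"
          using H'(2) by (auto simp: subgraph_def)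
        with verts H' show False
          by (auto simp: subgraph_def compatible_def)
      qed
    qed
    then show "H \<in> connected_components G"
      by (simp add: connected_components_def)
  qed
qed

text \<open>Each value in the image has a nonempty fibre, so different values give different induced
  subdigraphs.\<close>

lemma card_connected_components_eq:
  assumes "wf_digraph G"
    and "\<And>e. e \<in> arcs G \<Longrightarrow> f (tail G e) = f (head G e)"
    and "\<And>u v. u \<in> verts G \<Longrightarrow> v \<in> verts G \<Longrightarrow> u \<noteq> v \<Longrightarrow> f u = f v \<Longrightarrow>
      (u, v) \<in> (arcs_ends G)\<^sup>s"
  shows "card (connected_components G) = card (f ` verts G)"
proof -
  have "inj_on (\<lambda>c. G \<restriction> {v \<in> verts G. f v = c}) (f ` verts G)"
  proof (rule inj_onI)
    fix c c'
    assume c: "c \<in> f ` verts G" and G: "G \<restriction> {v \<in> verts G. f v = c} = G \<restriction> {v \<in> verts G. f v = c'}"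
    have eq: "{v \<in> verts G. f v = c} = {v \<in> verts G. f v = c'}"
      using arg_cong[OF G, of verts] by (simp only: induce_subgraph_verts)
    obtain u where "u \<in> verts G" "f u = c"
      using c by blast
    then have "u \<in> {v \<in> verts G. f v = c'}"
      unfolding eq[symmetric] by simp
    with \<open>f u = c\<close> show "c = c'"
      by simp
  qed
  then have "card ((\<lambda>c. G \<restriction> {v \<in> verts G. f v = c}) ` f ` verts G) = card (f ` verts G)"
    by (rule card_image)
  moreover have "connected_components G = (\<lambda>c. G \<restriction> {v \<in> verts G. f v = c}) ` f ` verts G"
    using assms by (rule connected_components_eq_fibres)
  ultimately show ?thesis
    by (simp only:)
qed

section \<open>Arcs inside the fibres of a map on the vertices\<close>

text \<open>The nullity of a tournament on \<open>n\<close> vertices, arranged additively so that it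
  can be summed over fibres before subtracting.\<close>

lemma choose_two_eq: "1 \<le> n \<Longrightarrow> (n choose 2) + 1 = n + ((n - 1) choose 2)"
  by (cases n) (simp_all add: numeral_2_eq_2)

context tournament
begin

lemma adjacentE:
  assumes "u \<in> verts G" "v \<in> verts G" "u \<noteq> v"
  obtains e where "e \<in> arcs G" "tail G e = u \<and> head G e = v \<or> tail G e = v \<and> head G e = u"
  using ex1_arc[OF assms] by (auto simp: arc_to_ends_def)

text \<open>Used later with \<open>f\<close> the block number of a vertex: every arc set in the
  lattice of cut complements has this form.\<close>

definition inner_arcs :: "('a \<Rightarrow> 'c) \<Rightarrow> 'b set" where
  "inner_arcs f = {e \<in> arcs G. f (tail G e) = f (head G e)}"

text \<open>In a tournament an arc is determined by its unordered pair of ends, and every pair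
  occurs. Hence the inner arcs correspond to the two-element subsets of the fibres.\<close>

lemma card_inner_arcs:
  "card (inner_arcs f) = (\<Sum>c\<in>f ` verts G. card {v \<in> verts G. f v = c} choose 2)"
proof -
  define P where "P c = {X. X \<subseteq> {v \<in> verts G. f v = c} \<and> card X = 2}" for c
  have "bij_betw (\<lambda>e. {tail G e, head G e}) (inner_arcs f) (\<Union>c\<in>f ` verts G. P c)"
    unfolding bij_betw_def
  proof
    show "inj_on (\<lambda>e. {tail G e, head G e}) (inner_arcs f)"
    proof (rule inj_onI)
      fix e e'
      assume e: "e \<in> inner_arcs f" and e': "e' \<in> inner_arcs f"
        and eq: "{tail G e, head G e} = {tail G e', head G e'}"
      have arcs: "e \<in> arcs G" "e' \<in> arcs G"
        using e e' by (auto simp: inner_arcs_def)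
      have "\<exists>!x. x \<in> arcs G \<and>
          (arc_to_ends G x = (tail G e, head G e) \<or> arc_to_ends G x = (head G e, tail G e))"
        using arcs no_loops by (intro ex1_arc) auto
      moreover have "arc_to_ends G e' = (tail G e, head G e) \<or> arc_to_ends G e' = (head G e, tail G e)"
        using eq by (auto simp: arc_to_ends_def doubleton_eq_iff)
      moreover have "arc_to_ends G e = (tail G e, head G e)"
        by (simp add: arc_to_ends_def)
      ultimately show "e = e'"
        using arcs by blast
    qed
    show "(\<lambda>e. {tail G e, head G e}) ` inner_arcs f = (\<Union>c\<in>f ` verts G. P c)"
    proof (intro equalityI subsetI)
      fix X
      assume "X \<in> (\<lambda>e. {tail G e, head G e}) ` inner_arcs f"
      then obtain e where e: "e \<in> arcs G" "f (tail G e) = f (head G e)" "X = {tail G e, head G e}"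
        by (auto simp: inner_arcs_def)
      then have "X \<in> P (f (tail G e))"
        using no_loops[of e] by (auto simp: P_def)
      moreover have "f (tail G e) \<in> f ` verts G"
        using e(1) by simp
      ultimately show "X \<in> (\<Union>c\<in>f ` verts G. P c)"
        by (rule UN_I[rotated])
    next
      fix X
      assume "X \<in> (\<Union>c\<in>f ` verts G. P c)"
      then obtain c where c: "X \<subseteq> {v \<in> verts G. f v = c}" "card X = 2"
        by (auto simp: P_def)
      then obtain u v where uv: "X = {u, v}" "u \<noteq> v"
        by (auto simp: card_2_iff)
      obtain e where e: "e \<in> arcs G" "tail G e = u \<and> head G e = v \<or> tail G e = v \<and> head G e = u"
        using c uv by (elim adjacentE[of u v, rotated 2]) auto
      then have "e \<in> inner_arcs f" "X = {tail G e, head G e}"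
        using c uv by (auto simp: inner_arcs_def)
      then show "X \<in> (\<lambda>e. {tail G e, head G e}) ` inner_arcs f"
        by (rule rev_image_eqI)
    qed
  qed
  then have "card (inner_arcs f) = card (\<Union>c\<in>f ` verts G. P c)"
    by (rule bij_betw_same_card)
  also have "\<dots> = (\<Sum>c\<in>f ` verts G. card (P c))"
  proof (rule card_UN_disjoint)
    show "\<forall>c\<in>f ` verts G. finite (P c)"
      by (simp add: P_def)
    show "\<forall>c\<in>f ` verts G. \<forall>c'\<in>f ` verts G. c \<noteq> c' \<longrightarrow> P c \<inter> P c' = {}"
    proof (intro ballI impI equals0I)
      fix c c' X
      assume "c \<noteq> c'" and X: "X \<in> P c \<inter> P c'"
      \<comment> \<open>A nonempty set cannot lie in two different fibres.\<close>
      then have "X \<noteq> {}"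
        by (auto simp: P_def)
      with X \<open>c \<noteq> c'\<close> show False
        by (auto simp: P_def)
    qed
  qed simp
  also have "\<dots> = (\<Sum>c\<in>f ` verts G. card {v \<in> verts G. f v = c} choose 2)"
    by (simp add: P_def n_subsets)
  finally show ?thesis .
qed

lemma card_components_inner_arcs:
  "card (connected_components (spanning_subdigraph G (inner_arcs f))) = card (f ` verts G)"
proof -
  let ?H = "spanning_subdigraph G (inner_arcs f)"
  have "card (connected_components ?H) = card (f ` verts ?H)"
  proof (rule card_connected_components_eq)
    show "wf_digraph ?H"
      by unfold_locales (auto simp: spanning_subdigraph_def inner_arcs_def)
  next
    fix e
    assume "e \<in> arcs ?H"
    then show "f (tail ?H e) = f (head ?H e)"
      by (simp add: spanning_subdigraph_def inner_arcs_def)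
  next
    fix u v
    assume uv: "u \<in> verts ?H" "v \<in> verts ?H" "u \<noteq> v" "f u = f v"
    then obtain e where e: "e \<in> arcs G" "tail G e = u \<and> head G e = v \<or> tail G e = v \<and> head G e = u"
      by (elim adjacentE[of u v, rotated 2]) (auto simp: spanning_subdigraph_def)
    then have "e \<in> arcs ?H"
      using uv by (auto simp: spanning_subdigraph_def inner_arcs_def)
    then show "(u, v) \<in> (arcs_ends ?H)\<^sup>s"
      using e by (auto simp: symcl_def arcs_ends_conv spanning_subdigraph_def)
  qed
  then show ?thesis
    by (simp add: spanning_subdigraph_def)
qed

lemma nullity_inner_arcs:
  "card (inner_arcs f) - rk G (inner_arcs f) =
    (\<Sum>c\<in>f ` verts G. (card {v \<in> verts G. f v = c} - 1) choose 2)"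
proof -
  \<comment> \<open>Keeps the subtraction inside \<open>rk\<close> from truncating.\<close>
  have "card (f ` verts G) \<le> card (verts G)"
    by (rule card_image_le) simp
  \<comment> \<open>One component per fibre: the added 1 goes into each summand, where
    \<open>choose_two_eq\<close> trades it for the fibre size, and these sizes add up to
    \<open>card (verts G)\<close>.\<close>
  moreover have "card (inner_arcs f) + card (f ` verts G) =
      (\<Sum>c\<in>f ` verts G. (card {v \<in> verts G. f v = c} choose 2) + 1)"
    unfolding card_inner_arcs sum.distrib by simp
  moreover have "\<dots> = (\<Sum>c\<in>f ` verts G. card {v \<in> verts G. f v = c} +
      ((card {v \<in> verts G. f v = c} - 1) choose 2))"
  proof (rule sum.cong)
    fix c
    assume "c \<in> f ` verts G"
    then have "0 < card {v \<in> verts G. f v = c}"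
      by (auto simp: card_gt_0_iff)
    then show "(card {v \<in> verts G. f v = c} choose 2) + 1 =
        card {v \<in> verts G. f v = c} + ((card {v \<in> verts G. f v = c} - 1) choose 2)"
      by (intro choose_two_eq) simp
  qed simp
  moreover have "(\<Sum>c\<in>f ` verts G. card {v \<in> verts G. f v = c}) = card (verts G)"
    using sum.image_gen[of "verts G" "\<lambda>_. 1 :: nat" f] by simp
  ultimately show ?thesis
    by (simp add: rk_def card_components_inner_arcs sum.distrib)
qed

end

section \<open>The lattice of unions of directed cuts\<close>

text \<open>Replaces the strong components by the index \<open>c v\<close> of the component of
  \<open>v\<close>, so that directed cuts become thresholds on numbers.\<close>

locale ranked_tournament = tournament +
  fixes c :: "'a \<Rightarrow> nat" and d :: nat
  assumes rank_range: "v \<in> verts G \<Longrightarrow> c v \<in> {1..d}"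
    and rank_surj: "i \<in> {1..d} \<Longrightarrow> \<exists>v\<in>verts G. c v = i"
    and rank_mono: "e \<in> arcs G \<Longrightarrow> c (tail G e) \<le> c (head G e)"
    and rank_eq_reachable: "u \<in> verts G \<Longrightarrow> v \<in> verts G \<Longrightarrow> c u = c v \<Longrightarrow> u \<rightarrow>\<^sup>*\<^bsub>G\<^esub> v"
begin

section \<open>Directed cuts as rank thresholds\<close>

definition level_cut :: "nat \<Rightarrow> 'b set" where
  "level_cut m = {e \<in> arcs G. c (tail G e) \<le> m \<and> m < c (head G e)}"

lemma arc_of_rank_less:
  assumes "u \<in> verts G" "v \<in> verts G" "c u < c v"
  obtains e where "e \<in> arcs G" "tail G e = u" "head G e = v"
proof (rule adjacentE[of u v])
  fix e
  assume e: "e \<in> arcs G" "tail G e = u \<and> head G e = v \<or> tail G e = v \<and> head G e = u"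
  then show thesis
    using rank_mono[of e] assms(3) by (intro that[of e]) auto
qed (use assms in auto)

text \<open>Such an arc lies in \<open>level_cut m\<close> and in no other level cut, so it detects
  whether \<open>m\<close> was used in a union.\<close>

lemma arc_between_consecutive_levels:
  assumes "m \<in> {1..<d}"
  obtains e where "e \<in> arcs G" "c (tail G e) = m" "c (head G e) = Suc m"
proof -
  obtain u v where uv: "u \<in> verts G" "c u = m" "v \<in> verts G" "c v = Suc m"
    using rank_surj[of m] rank_surj[of "Suc m"] assms by auto
  obtain e where "e \<in> arcs G" "tail G e = u" "head G e = v"
    by (rule arc_of_rank_less[of u v]) (use uv in auto)
  with uv show thesis
    by (intro that[of e]) auto
qed

lemma directed_cut_level_cut:
  assumes "m \<in> {1..<d}"
  shows "directed_cut G (level_cut m)"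
  unfolding directed_cut_def
proof
  show "level_cut m \<noteq> {}"
    by (rule arc_between_consecutive_levels[OF assms]) (auto simp: level_cut_def)
  let ?X = "{v \<in> verts G. c v \<le> m}"
  have "level_cut m = {e \<in> arcs G. tail G e \<in> ?X \<and> head G e \<in> verts G - ?X}"
    by (auto simp: level_cut_def)
  moreover have "\<not> (\<exists>e\<in>arcs G. tail G e \<in> verts G - ?X \<and> head G e \<in> ?X)"
    using rank_mono by fastforce
  ultimately show "\<exists>X\<subseteq>verts G. level_cut m = {e \<in> arcs G. tail G e \<in> X \<and> head G e \<in> verts G - X} \<and>
      \<not> (\<exists>e\<in>arcs G. tail G e \<in> verts G - X \<and> head G e \<in> X)"
    by (intro exI[of _ ?X]) auto
qed

text \<open>The side \<open>X\<close> is closed under predecessors. Let \<open>u\<close> in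
  \<open>X\<close> have the largest rank \<open>m\<close>: vertices of smaller rank have an arc to
  \<open>u\<close> and vertices of rank \<open>m\<close> reach \<open>u\<close>, so all of them lie
  in \<open>X\<close>.\<close>

lemma directed_cut_imp_level_cut:
  assumes "directed_cut G C"
  shows "\<exists>m\<in>{1..<d}. C = level_cut m"
proof -
  obtain X where X: "X \<subseteq> verts G" "C = {e \<in> arcs G. tail G e \<in> X \<and> head G e \<in> verts G - X}"
    and no_entering: "\<not> (\<exists>e\<in>arcs G. tail G e \<in> verts G - X \<and> head G e \<in> X)" and "C \<noteq> {}"
    using assms unfolding directed_cut_def by blast
  have closed: "tail G e \<in> X" if "e \<in> arcs G" "head G e \<in> X" for e
    using that no_entering tail_in_verts[of e] by blast
  obtain e0 where e0: "e0 \<in> arcs G" "tail G e0 \<in> X" "head G e0 \<notin> X"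
    using X \<open>C \<noteq> {}\<close> by auto
  define m where "m = Max (c ` X)"
  have fin: "finite (c ` X)"
    using finite_subset[OF X(1)] by simp
  have le_m: "c v \<le> m" if "v \<in> X" for v
    unfolding m_def using fin that by (intro Max_ge) auto
  have "m \<in> c ` X"
    unfolding m_def using fin e0 by (intro Max_in) auto
  then obtain u where u: "u \<in> X" "c u = m"
    by auto
  have u_verts: "u \<in> verts G"
    using u X by auto
  have X_eq: "X = {v \<in> verts G. c v \<le> m}"
  proof (intro equalityI subsetI)
    fix v
    assume "v \<in> X"
    then show "v \<in> {v \<in> verts G. c v \<le> m}"
      using le_m X by auto
  next
    fix v
    assume v: "v \<in> {v \<in> verts G. c v \<le> m}"
    show "v \<in> X"
    proof (cases "c v = m")
      case True
      then have "v \<rightarrow>\<^sup>*\<^bsub>G\<^esub> u"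
        using v u u_verts by (intro rank_eq_reachable) auto
      then show ?thesis
      proof (induction rule: converse_reachable_induct)
        case base
        show ?case
          by (rule u)
      next
        case (step x y)
        then show ?case
          using closed by (auto simp: arcs_ends_conv)
      qed
    next
      case False
      obtain e where "e \<in> arcs G" "tail G e = v" "head G e = u"
        by (rule arc_of_rank_less[of v u]) (use v u u_verts False in auto)
      then show ?thesis
        using closed[of e] u by simp
    qed
  qed
  have "1 \<le> m"
    using rank_range[OF u_verts] u by simp
  \<comment> \<open>The head of the cut arc \<open>e0\<close> lies outside \<open>X\<close>, so its
    rank exceeds \<open>m\<close>.\<close>
  moreover have "m < d"
    using rank_range[of "head G e0"] e0 by (auto simp: X_eq)
  moreover have "C = level_cut m"
    unfolding X(2) X_eq level_cut_def by auto
  ultimately show ?thesis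
    by auto
qed

section \<open>The Boolean lattice of cut complements\<close>

definition block_arcs :: "nat set \<Rightarrow> 'b set" where
  "block_arcs S = inner_arcs (\<lambda>v. block_of S (c v))"

text \<open>Ranks never drop along an arc, so an arc changes block exactly when a threshold in
  \<open>S\<close> separates its ends. The block form serves the counting, the other form the
  lattice arguments.\<close>

lemma block_arcs_eq: "finite S \<Longrightarrow> block_arcs S = arcs G - \<Union> (level_cut ` S)"
  unfolding block_arcs_def inner_arcs_def level_cut_def
  using block_of_eq_iff[OF _ rank_mono] by auto

lemma dicut_complements_eq: "dicut_complements G = block_arcs ` Pow {1..<d}"
proof -
  have "{C. directed_cut G C} = level_cut ` {1..<d}"
    using directed_cut_level_cut directed_cut_imp_level_cut by (intro equalityI subsetI) auto
  then have "dicut_complements G = (\<lambda>S. arcs G - \<Union> (level_cut ` S)) ` Pow {1..<d}"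
    by (auto simp: dicut_complements_def subset_image_iff)
  also have "\<dots> = block_arcs ` Pow {1..<d}"
    by (intro image_cong refl block_arcs_eq[symmetric]) (auto intro: finite_subset)
  finally show ?thesis .
qed

lemma block_arcs_subset_iff:
  assumes S: "S \<subseteq> {1..<d}" and T: "T \<subseteq> {1..<d}"
  shows "block_arcs T \<subseteq> block_arcs S \<longleftrightarrow> S \<subseteq> T"
proof
  have fin: "finite S" "finite T"
    using S T by (auto intro: finite_subset)
  show "block_arcs T \<subseteq> block_arcs S" if "S \<subseteq> T"
    using that fin by (auto simp: block_arcs_eq)
  show "S \<subseteq> T" if "block_arcs T \<subseteq> block_arcs S"
  proof
    fix m
    assume m: "m \<in> S"
    obtain e where e: "e \<in> arcs G" "c (tail G e) = m" "c (head G e) = Suc m"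
      by (rule arc_between_consecutive_levels[of m]) (use m S in auto)
    then have "e \<notin> block_arcs S"
      using m fin by (auto simp: block_arcs_eq level_cut_def)
    then have "e \<notin> block_arcs T"
      using that by auto
    \<comment> \<open>Only the threshold \<open>m\<close> separates the levels \<open>m\<close> and
      \<open>Suc m\<close>, so \<open>m'\<close> is \<open>m\<close>.\<close>
    then obtain m' where "m' \<in> T" "m \<le> m'" "m' < Suc m"
      using e fin by (auto simp: block_arcs_eq level_cut_def)
    then show "m \<in> T"
      by (simp add: less_Suc_eq_le)
  qed
qed

lemma inj_on_block_arcs: "inj_on block_arcs (Pow {1..<d})"
proof (rule inj_onI)
  fix S T
  assume "S \<in> Pow {1..<d}" "T \<in> Pow {1..<d}" "block_arcs S = block_arcs T"
  then show "S = T"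
    using block_arcs_subset_iff[of S T] block_arcs_subset_iff[of T S] by auto
qed

text \<open>A larger index set removes more arcs, so reverse inclusion of arc sets is inclusion of
  index sets, with bottom \<open>block_arcs {} = arcs G\<close>.\<close>

lemma mobius_block_arcs:
  assumes "S \<subseteq> {1..<d}"
  shows "mobius (dicut_order G) (arcs G) (block_arcs S) = (-1) ^ card S"
proof -
  have "mobius (dicut_order G) (block_arcs {}) (block_arcs S) = (-1) ^ card S"
  proof (rule mobius_Boolean)
    show "(x, y) \<in> dicut_order G \<longleftrightarrow>
        (\<exists>S T. x = block_arcs S \<and> y = block_arcs T \<and> S \<subseteq> T \<and> T \<subseteq> {1..<d})" for x y
    proof
      assume "(x, y) \<in> dicut_order G"
      then obtain S T where "x = block_arcs S" "S \<subseteq> {1..<d}" "y = block_arcs T" "T \<subseteq> {1..<d}" "y \<subseteq> x"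
        by (auto simp: dicut_order_def dicut_complements_eq)
      then show "\<exists>S T. x = block_arcs S \<and> y = block_arcs T \<and> S \<subseteq> T \<and> T \<subseteq> {1..<d}"
        using block_arcs_subset_iff by metis
    next
      assume "\<exists>S T. x = block_arcs S \<and> y = block_arcs T \<and> S \<subseteq> T \<and> T \<subseteq> {1..<d}"
      then obtain S T where "x = block_arcs S" "y = block_arcs T" "S \<subseteq> T" "T \<subseteq> {1..<d}"
        by blast
      moreover have "block_arcs T \<subseteq> block_arcs S"
        using calculation by (subst block_arcs_subset_iff) auto
      ultimately show "(x, y) \<in> dicut_order G"
        by (auto simp: dicut_order_def dicut_complements_eq)
    qed
  qed (use assms inj_on_block_arcs in \<open>simp_all add: finite_dicut_order Partial_order_dicut_order\<close>)
  then show ?thesis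
    by (simp add: block_arcs_eq)
qed

text \<open>The fibres of the block number are the blocks of the composition; splitting each by
  component index gives \<open>block_size\<close> as its number of vertices.\<close>

lemma nullity_block_arcs:
  assumes ds: "ds \<in> compositions d p"
    and k: "\<And>i. i \<in> {1..d} \<Longrightarrow> k i = card {v \<in> verts G. c v = i}"
    and p: "1 \<le> p"
  shows "card (block_arcs (cuts ds)) - rk G (block_arcs (cuts ds)) =
    (\<Sum>j = 1..p. (block_size k ds j - 1) choose 2)"
proof -
  let ?f = "\<lambda>v. block_of (cuts ds) (c v)"
  have image: "?f ` verts G = (\<lambda>j. j - 1) ` {1..p}"
  proof (intro equalityI subsetI)
    fix i
    assume "i \<in> ?f ` verts G"
    then obtain s where s: "i = block_of (cuts ds) s"
      by auto
    have "i \<le> card (cuts ds)"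
      unfolding s block_of_def using cuts_subset[OF ds]
      by (intro card_mono) (auto intro: finite_subset)
    then have "i < p"
      using p by (simp add: card_cuts[OF ds])
    then show "i \<in> (\<lambda>j. j - 1) ` {1..p}"
      by (intro image_eqI[of _ _ "Suc i"]) auto
  next
    fix i
    assume "i \<in> (\<lambda>j. j - 1) ` {1..p}"
    then obtain j where j: "i = j - 1" "1 \<le> j" "j \<le> p"
      by auto
    have "partial_sum ds (j - 1) < partial_sum ds j"
      using j by (intro partial_sum_less[OF ds]) auto
    \<comment> \<open>The last component index of block \<open>j\<close> witnesses that the block is
      inhabited.\<close>
    then have "partial_sum ds j \<in> {partial_sum ds (j - 1) + 1..partial_sum ds j}"
      by simp
    then have *: "partial_sum ds j \<in> {1..d}" "block_of (cuts ds) (partial_sum ds j) = i"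
      unfolding block_of_cuts_fibre[OF ds j(2,3), symmetric] using j by auto
    then obtain v where "v \<in> verts G" "c v = partial_sum ds j"
      using rank_surj by blast
    then show "i \<in> ?f ` verts G"
      using * by (intro image_eqI[of _ _ v]) auto
  qed
  have fibre: "card {v \<in> verts G. ?f v = j - 1} = block_size k ds j" if "j \<in> {1..p}" for j
  proof -
    let ?I = "{s. s \<in> {1..d} \<and> block_of (cuts ds) s = j - 1}"
    have "{v \<in> verts G. ?f v = j - 1} = (\<Union>s\<in>?I. {v \<in> verts G. c v = s})"
      using rank_range by auto
    also have "card \<dots> = (\<Sum>s\<in>?I. card {v \<in> verts G. c v = s})"
      by (rule card_UN_disjoint) (simp, simp, blast)
    also have "\<dots> = (\<Sum>s\<in>?I. k s)"
      by (rule sum.cong) (simp_all add: k)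
    also have "\<dots> = block_size k ds j"
      using that by (subst block_size_eq[OF ds]) simp_all
    finally show ?thesis .
  qed
  have "card (block_arcs (cuts ds)) - rk G (block_arcs (cuts ds)) =
      (\<Sum>i\<in>(\<lambda>j. j - 1) ` {1..p}. (card {v \<in> verts G. ?f v = i} - 1) choose 2)"
    unfolding block_arcs_def nullity_inner_arcs image ..
  also have "\<dots> = (\<Sum>j = 1..p. (card {v \<in> verts G. ?f v = j - 1} - 1) choose 2)"
    by (subst sum.reindex) (auto intro!: inj_onI)
  also have "\<dots> = (\<Sum>j = 1..p. (block_size k ds j - 1) choose 2)"
    by (rule sum.cong) (simp_all only: fibre)
  finally show ?thesis .
qed

end

section \<open>The NL-flow polynomial of a tournament\<close>

lemma monom_1_sum: "monom (1 :: 'a :: comm_semiring_1) (\<Sum>i\<in>A. f i) = (\<Prod>i\<in>A. monom 1 (f i))"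
proof (induction A rule: infinite_finite_induct)
  case (insert x F)
  have "monom (1 :: 'a) (f x + sum f F) = monom 1 (f x) * monom 1 (sum f F)"
    by (simp add: mult_monom)
  with insert show ?case
    by simp
qed simp_all

lemma monom_neg_one_power: "monom ((-1) ^ m) n = (-1) ^ m * monom (1 :: int) n"
  by (cases "even m") (simp_all add: minus_monom)

lemma (in ranked_tournament) nl_flow_poly_eq:
  assumes k: "\<And>i. i \<in> {1..d} \<Longrightarrow> k i = card {v \<in> verts G. c v = i}" and d: "1 \<le> d"
  shows "nl_flow_poly G = (\<Sum>p = 1..d. (-1) ^ (p - 1) *
    (\<Sum>ds\<in>compositions d p. \<Prod>j = 1..p. monom 1 ((block_size k ds j - 1) choose 2)))"
proof -
  define h where "h S = monom ((-1 :: int) ^ card S) (card (block_arcs S) - rk G (block_arcs S))" for S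
  have "nl_flow_poly G = (\<Sum>S\<in>Pow {1..<d}. h S)"
    unfolding nl_flow_poly_def dicut_complements_eq
    by (subst sum.reindex[OF inj_on_block_arcs]) (simp add: mobius_block_arcs h_def)
  \<comment> \<open>Grouping by the number \<open>p\<close> of blocks, one more than the number of
    cuts; at most \<open>d - 1\<close> cuts are available.\<close>
  also have "\<dots> = (\<Sum>p = 1..d. \<Sum>S | S \<in> Pow {1..<d} \<and> card S + 1 = p. h S)"
  proof (rule sum.group[symmetric])
    show "(\<lambda>S. card S + 1) ` Pow {1..<d} \<subseteq> {1..d}"
    proof safe
      fix S
      assume "S \<subseteq> {1..<d}"
      then have "card S \<le> card {1..<d}"
        by (intro card_mono) auto
      then show "card S + 1 \<in> {1..d}"
        using d by simp
    qed
  qed auto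
  also have "\<dots> = (\<Sum>p = 1..d. (-1) ^ (p - 1) *
    (\<Sum>ds\<in>compositions d p. \<Prod>j = 1..p. monom 1 ((block_size k ds j - 1) choose 2)))"
  proof (rule sum.cong)
    fix p
    assume "p \<in> {1..d}"
    then have p: "1 \<le> p"
      by simp
    have "{S. S \<in> Pow {1..<d} \<and> card S + 1 = p} = {S. S \<subseteq> {1..<d} \<and> card S = p - 1}"
      using p by auto
    then have "(\<Sum>S | S \<in> Pow {1..<d} \<and> card S + 1 = p. h S) = (\<Sum>ds\<in>compositions d p. h (cuts ds))"
      using sum.reindex_bij_betw[OF bij_betw_cuts[OF p d], of h] by simp
    also have "\<dots> = (\<Sum>ds\<in>compositions d p. (-1) ^ (p - 1) *
        (\<Prod>j = 1..p. monom 1 ((block_size k ds j - 1) choose 2)))"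
    proof (rule sum.cong)
      fix ds
      assume ds: "ds \<in> compositions d p"
      have "card (block_arcs (cuts ds)) - rk G (block_arcs (cuts ds)) =
          (\<Sum>j = 1..p. (block_size k ds j - 1) choose 2)"
        using ds k p by (rule nullity_block_arcs)
      then show "h (cuts ds) = (-1) ^ (p - 1) * (\<Prod>j = 1..p. monom 1 ((block_size k ds j - 1) choose 2))"
        by (simp only: h_def card_cuts[OF ds] monom_neg_one_power monom_1_sum)
    qed simp
    finally show "(\<Sum>S | S \<in> Pow {1..<d} \<and> card S + 1 = p. h S) = (-1) ^ (p - 1) *
        (\<Sum>ds\<in>compositions d p. \<Prod>j = 1..p. monom 1 ((block_size k ds j - 1) choose 2))"
      by (simp add: sum_distrib_left)
  qed simp
  finally show ?thesis .
qed

section \<open>The component index as a rank function\<close>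

theorem theorem9:
  fixes G :: "('a, 'b) pre_digraph" and d :: nat
    and K :: "nat \<Rightarrow> ('a, 'b) pre_digraph" and k :: "nat \<Rightarrow> nat"
  assumes "tournament G"
    and "d \<ge> 1"
    and "sccs_topologically_ordered G d K"
    and "\<And>i. i \<in> {1..d} \<Longrightarrow> k i = card (verts (K i))"
  shows "nl_flow_poly G =
    (\<Sum>p = 1..d. (-1) ^ (p - 1) *
      (\<Sum>ds\<in>compositions d p. \<Prod>j = 1..p. monom 1 ((block_size k ds j - 1) choose 2)))"
proof -
  interpret tournament G
    by (rule assms)
  have bij: "bij_betw K {1..d} sccs"
    and ordered: "\<And>i j e. \<lbrakk>i \<in> {1..d}; j \<in> {1..d}; i < j; e \<in> arcs G;
      tail G e \<in> verts (K j); head G e \<in> verts (K i)\<rbrakk> \<Longrightarrow> tail G e \<in> verts (K i)"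
    using assms(3) unfolding sccs_topologically_ordered_def by blast+
  have K: "K i \<in> sccs" "verts (K i) \<in> sccs_verts" if "i \<in> {1..d}" for i
    using bij that by (auto simp: sccs_verts_conv bij_betw_def)
  have disjoint: "i = j" if "i \<in> {1..d}" "j \<in> {1..d}" "v \<in> verts (K i)" "v \<in> verts (K j)" for i j v
  proof -
    \<comment> \<open>A common vertex forces equal vertex sets, hence equal components, and
      \<open>K\<close> is injective.\<close>
    have "verts (K i) = verts (K j)"
      using sccs_verts_disjoint[of "verts (K i)" "verts (K j)"] K that by blast
    then have "K i = K j"
      using K that by (intro in_sccs_subset_imp_eq) auto
    then show ?thesis
      using bij that by (auto simp: bij_betw_def dest: inj_onD)
  qed
  have cover: "\<exists>i\<in>{1..d}. v \<in> verts (K i)" if "v \<in> verts G" for v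
  proof -
    have "scc_of v \<in> verts ` K ` {1..d}"
      using scc_of_in_sccs_verts[OF that] bij by (simp add: sccs_verts_conv bij_betw_def)
    then show ?thesis
      using in_scc_of_self[OF that] by auto
  qed
  \<comment> \<open>For a vertex of \<open>G\<close> the choice has exactly one candidate, by
    \<open>cover\<close> and \<open>disjoint\<close>.\<close>
  define c where "c v = (SOME i. i \<in> {1..d} \<and> v \<in> verts (K i))" for v
  have c: "c v \<in> {1..d}" "v \<in> verts (K (c v))" if "v \<in> verts G" for v
    using someI_ex[of "\<lambda>i. i \<in> {1..d} \<and> v \<in> verts (K i)"] cover[OF that]
    unfolding c_def by blast+
  have verts_K: "verts (K i) = {v \<in> verts G. c v = i}" if "i \<in> {1..d}" for i
  proof (intro equalityI subsetI)
    fix v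
    assume v: "v \<in> verts (K i)"
    have "subgraph (K i) G"
      using in_sccs_imp_induced[OF K(1)[OF that]] by (rule induced_imp_subgraph)
    then have "v \<in> verts G"
      using v subgraph_imp_subverts by blast
    then show "v \<in> {v \<in> verts G. c v = i}"
      using c[of v] disjoint[of "c v" i v] v that by simp
  next
    fix v
    assume "v \<in> {v \<in> verts G. c v = i}"
    then show "v \<in> verts (K i)"
      using c(2)[of v] by auto
  qed
  interpret ranked_tournament G c d
  proof
    show "c v \<in> {1..d}" if "v \<in> verts G" for v
      using that by (rule c)
    show "\<exists>v\<in>verts G. c v = i" if "i \<in> {1..d}" for i
      using K(2)[OF that] verts_K[OF that] by (auto simp: in_sccs_verts_conv_reachable)
    show "c (tail G e) \<le> c (head G e)" if e: "e \<in> arcs G" for e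
    proof (rule ccontr)
      assume "\<not> c (tail G e) \<le> c (head G e)"
      \<comment> \<open>The topological order would put the tail of a descending arc into the
        earlier component as well, against disjointness.\<close>
      then have "tail G e \<in> verts (K (c (head G e)))"
        using e by (intro ordered[of "c (head G e)" "c (tail G e)" e] c) auto
      then have "c (tail G e) = c (head G e)"
        using e c verts_K by simp
      with \<open>\<not> c (tail G e) \<le> c (head G e)\<close> show False
        by simp
    qed
    show "u \<rightarrow>\<^sup>*\<^bsub>G\<^esub> v" if "u \<in> verts G" "v \<in> verts G" "c u = c v" for u v
      using K(2)[OF c(1)[OF that(1)]] c(2)[OF that(1)] c(2)[OF that(2)] that(3)
      by (auto simp: in_sccs_verts_conv_reachable)
  qed
  show ?thesis
    using assms(2,4) verts_K by (intro nl_flow_poly_eq) auto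
qed

end
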